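(* For a countable binary relational structure $\mathbb{X}=\langle\omega,\rho\rangle$ the following are equivalent: (a) $\mathbb{P}(\mathbb{X})=[\omega]^\omega$; (b) $\mathbb{P}(\mathbb{X})$ is dense in $\langle[\omega]^\omega,\subseteq\rangle$; (c) $\mathbb{X}$ is isomorphic to one of: $\langle\omega,\emptyset\rangle$; the complete graph $\langle\omega,\omega^2\setminus\Delta_\omega\rangle$; $\langle\omega,<\rangle$; $\langle\omega,<^{-1}\rangle$; $\langle\omega,\Delta_\omega\rangle$; $\langle\omega,\omega^2\rangle$; $\langle\omega,\le\rangle$; $\langle\omega,\le^{-1}\rangle$; (d) $\mathbb{P}(\mathbb{X})$ is somewhere dense in $\langle[\omega]^\omega,\subseteq\rangle$; (e) $\mathcal{I}_{\mathbb{X}}=\mathrm{Fin}$. Moreover, in this case the separative quotient $\mathrm{sq}\langle\mathbb{P}(\mathbb{X}),\subseteq\rangle=(P(\omega)/\mathrm{Fin})^+$ is atomless and $\sigma$-closed.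
   Context: $\mathbb{P}(\mathbb{X})$ is the set of all $A\subseteq\omega$ such that $\langle A,\rho\cap A^2\rangle\cong\mathbb{X}$; $\mathcal{I}_{\mathbb{X}}=\{I\subseteq\omega:\neg\exists A\in\mathbb{P}(\mathbb{X})\ A\subseteq I\}$; $\mathrm{Fin}$ is the ideal of finite subsets of $\omega$; $\Delta_\omega=\{\langle n,n\rangle:n\in\omega\}$; $[\omega]^\omega$ is the set of infinite subsets of $\omega$. A set $S$ is somewhere dense in a poset $\langle P,\le\rangle$ iff there is $p\in P$ such that for every $q\le p$ there is $s\in S$ with $s\le q$. The separative quotient of a poset $\langle P,\le\rangle$ is $P/{=^*}$ ordered by $[p]\trianglelefteq[q]$ iff $p\le^*q$, where $p\le^*q$ iff $\forall r\le p\ \exists s\le r\ s\le q$ and $p=^*q$ iff $p\le^*q\wedge q\le^*p$. $(P(\omega)/\mathrm{Fin})^+$ is the poset of infinite subsets of $\omega$ modulo finite, ordered by almost inclusion. *)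

theory Defs
  imports Main
begin

text \<open>
  A binary structure, in particular a poset, is a pair of a carrier and a relation. For a poset
  the relation consists of the pairs \<open>(p, q)\<close> with \<open>p \<le> q\<close>.
\<close>

type_synonym 'a struct = "'a set \<times> 'a rel"

definition isomorphic :: "'a struct \<Rightarrow> 'b struct \<Rightarrow> bool" where
  "isomorphic X Y \<longleftrightarrow>
     (\<exists>f. bij_betw f (fst X) (fst Y) \<and>
          (\<forall>x\<in>fst X. \<forall>y\<in>fst X. (x, y) \<in> snd X \<longleftrightarrow> (f x, f y) \<in> snd Y))"

definition copies :: "nat rel \<Rightarrow> nat set set" where
  "copies \<rho> = {A. isomorphic (A, \<rho> \<inter> A \<times> A) (UNIV, \<rho>)}"

definition copy_ideal :: "nat rel \<Rightarrow> nat set set" where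
  "copy_ideal \<rho> = {I. \<not> (\<exists>A\<in>copies \<rho>. A \<subseteq> I)}"

definition Fin :: "nat set set" where
  "Fin = {I. finite I}"

definition infinite_sets :: "nat set set" where
  "infinite_sets = {A. infinite A}"

definition inclusion_poset :: "'a set set \<Rightarrow> 'a set struct" where
  "inclusion_poset F = (F, {(A, B). A \<in> F \<and> B \<in> F \<and> A \<subseteq> B})"

definition dense_in :: "'a set \<Rightarrow> 'a struct \<Rightarrow> bool" where
  "dense_in S P \<longleftrightarrow> S \<subseteq> fst P \<and> (\<forall>p\<in>fst P. \<exists>s\<in>S. (s, p) \<in> snd P)"

definition somewhere_dense_in :: "'a set \<Rightarrow> 'a struct \<Rightarrow> bool" where
  "somewhere_dense_in S P \<longleftrightarrow> S \<subseteq> fst P \<and>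
     (\<exists>p\<in>fst P. \<forall>q\<in>fst P. (q, p) \<in> snd P \<longrightarrow> (\<exists>s\<in>S. (s, q) \<in> snd P))"

text \<open>The relations \<open>\<le>\<^sup>*\<close> and \<open>=\<^sup>*\<close> of a poset.\<close>

definition sep_le :: "'a struct \<Rightarrow> 'a rel" where
  "sep_le P = {(p, q). p \<in> fst P \<and> q \<in> fst P \<and>
     (\<forall>r\<in>fst P. (r, p) \<in> snd P \<longrightarrow> (\<exists>s\<in>fst P. (s, r) \<in> snd P \<and> (s, q) \<in> snd P))}"

definition sep_eq :: "'a struct \<Rightarrow> 'a rel" where
  "sep_eq P = sep_le P \<inter> (sep_le P)\<inverse>"

definition separative_quotient :: "'a struct \<Rightarrow> 'a set struct" where
  "separative_quotient P =
     (fst P // sep_eq P, {(sep_eq P `` {p}, sep_eq P `` {q}) |p q. (p, q) \<in> sep_le P})"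

definition almost_subset :: "nat set rel" where
  "almost_subset = {(A, B). infinite A \<and> infinite B \<and> finite (A - B)}"

definition almost_equal :: "nat set rel" where
  "almost_equal = almost_subset \<inter> almost_subset\<inverse>"

text \<open>
  The poset \<open>(P(\<omega>)/Fin)\<^sup>+\<close>. A set that differs from an infinite set by a finite set is
  infinite, so the classes of infinite sets under \<open>almost_equal\<close> are precisely the nonzero
  elements of \<open>P(\<omega>)/Fin\<close>.
\<close>

definition Pomega_mod_Fin_plus :: "nat set set struct" where
  "Pomega_mod_Fin_plus =
     (infinite_sets // almost_equal,
      {(almost_equal `` {A}, almost_equal `` {B}) |A B. (A, B) \<in> almost_subset})"

text \<open>
  An atom is an element below which any two elements are compatible (the usual notion in forcing,
  not minimality).
\<close>

definition compatible_in :: "'a struct \<Rightarrow> 'a \<Rightarrow> 'a \<Rightarrow> bool" where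
  "compatible_in P q r \<longleftrightarrow> (\<exists>s\<in>fst P. (s, q) \<in> snd P \<and> (s, r) \<in> snd P)"

definition atom_in :: "'a struct \<Rightarrow> 'a \<Rightarrow> bool" where
  "atom_in P p \<longleftrightarrow> p \<in> fst P \<and>
     (\<forall>q\<in>fst P. \<forall>r\<in>fst P. (q, p) \<in> snd P \<longrightarrow> (r, p) \<in> snd P \<longrightarrow> compatible_in P q r)"

definition atomless :: "'a struct \<Rightarrow> bool" where
  "atomless P \<longleftrightarrow> \<not> (\<exists>p. atom_in P p)"

definition sigma_closed :: "'a struct \<Rightarrow> bool" where
  "sigma_closed P \<longleftrightarrow>
     (\<forall>p :: nat \<Rightarrow> 'a. (\<forall>n. p n \<in> fst P) \<and> (\<forall>n. (p (Suc n), p n) \<in> snd P) \<longrightarrow>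
        (\<exists>q\<in>fst P. \<forall>n. (q, p n) \<in> snd P))"

end

theory Submission
  imports Defs "HOL-Library.Ramsey"
begin

text \<open>
  By Ramsey's theorem every infinite set contains an infinite set \<open>H\<close> on which loops and the two
  directions of the relation between \<open>x < y\<close> do not depend on the points. The increasing
  enumeration identifies the structure on any infinite subset of \<open>H\<close> with one of the eight
  relations obtained by prescribing these three truth values on \<open>\<nat>\<close>. So as soon as the copies are
  dense below some set, one of them is of this form. Conversely, such a relation is isomorphic to
  its restriction to any infinite set. If all infinite sets are copies, the separative
  order of inclusion is almost inclusion, and pseudo-intersections give \<open>\<sigma>\<close>-closedness.
\<close>

section \<open>Isomorphism of structures and copies\<close>

lemma isomorphic_refl: "isomorphic X X"
  unfolding isomorphic_def by (rule exI[of _ id]) auto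

lemma isomorphic_sym:
  assumes "isomorphic X Y"
  shows "isomorphic Y X"
proof -
  obtain f where f: "bij_betw f (fst X) (fst Y)"
    and r: "\<forall>x\<in>fst X. \<forall>y\<in>fst X. (x, y) \<in> snd X \<longleftrightarrow> (f x, f y) \<in> snd Y"
    using assms unfolding isomorphic_def by blast
  let ?g = "inv_into (fst X) f"
  have g: "bij_betw ?g (fst Y) (fst X)"
    using f by (rule bij_betw_inv_into)
  have "(x, y) \<in> snd Y \<longleftrightarrow> (?g x, ?g y) \<in> snd X" if "x \<in> fst Y" "y \<in> fst Y" for x y
    using r that bij_betwE[OF g] bij_betw_inv_into_right[OF f] by metis
  with g show ?thesis
    unfolding isomorphic_def by blast
qed

lemma isomorphic_trans:
  assumes "isomorphic X Y" "isomorphic Y Z"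
  shows "isomorphic X Z"
proof -
  obtain f where f: "bij_betw f (fst X) (fst Y)"
    and rf: "\<forall>x\<in>fst X. \<forall>y\<in>fst X. (x, y) \<in> snd X \<longleftrightarrow> (f x, f y) \<in> snd Y"
    using assms(1) unfolding isomorphic_def by blast
  obtain g where g: "bij_betw g (fst Y) (fst Z)"
    and rg: "\<forall>x\<in>fst Y. \<forall>y\<in>fst Y. (x, y) \<in> snd Y \<longleftrightarrow> (g x, g y) \<in> snd Z"
    using assms(2) unfolding isomorphic_def by blast
  have "(x, y) \<in> snd X \<longleftrightarrow> ((g \<circ> f) x, (g \<circ> f) y) \<in> snd Z" if "x \<in> fst X" "y \<in> fst X" for x y
    using rf rg that bij_betwE[OF f] by simp
  with bij_betw_trans[OF f g] show ?thesis
    unfolding isomorphic_def by blast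
qed

lemma UNIV_in_copies: "UNIV \<in> copies \<rho>"
  by (simp add: copies_def isomorphic_refl)

lemma copies_subset_infinite_sets: "copies \<rho> \<subseteq> infinite_sets"
  by (auto simp: copies_def infinite_sets_def isomorphic_def dest: bij_betw_finite)

section \<open>The eight relations of condition (c) as one family with three Boolean
  parameters\<close>

definition canonical :: "bool \<Rightarrow> bool \<Rightarrow> bool \<Rightarrow> nat rel" where
  "canonical p q r = {(m, n). m < n \<and> p \<or> n < m \<and> q \<or> m = n \<and> r}"

lemma canonical_relations:
  "{{}, UNIV - Id, {(m, n). m < n}, {(m, n). m < n}\<inverse>,
    Id, UNIV, {(m, n). m \<le> n}, {(m, n). m \<le> n}\<inverse>} = {canonical p q r | p q r. True}"
proof -
  have "canonical False False False = {}" "canonical True True False = UNIV - Id"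
    "canonical True False False = {(m, n). m < n}" "canonical False True False = {(m, n). m < n}\<inverse>"
    "canonical False False True = Id" "canonical True True True = UNIV"
    "canonical True False True = {(m, n). m \<le> n}" "canonical False True True = {(m, n). m \<le> n}\<inverse>"
    unfolding canonical_def by auto
  moreover have "{canonical p q r | p q r. True} =
      {canonical False False False, canonical True True False, canonical True False False,
       canonical False True False, canonical False False True, canonical True True True,
       canonical True False True, canonical False True True}"
    (is "?L = ?R")
  proof
    show "?L \<subseteq> ?R"
    proof
      fix \<sigma> assume "\<sigma> \<in> ?L"
      then obtain p q r where "\<sigma> = canonical p q r" by blast
      then show "\<sigma> \<in> ?R"
        by (cases p; cases q; cases r) simp_all
    qed
  qed blast
  ultimately show ?thesis
    by simp
qed

text \<open>Whether a pair lies in \<open>canonical p q r\<close> depends only on how its entries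
  compare, so every strictly increasing map preserves and reflects the relation. The increasing
  enumeration of \<open>A\<close> is such a map from the naturals onto \<open>A\<close>; it gives
  the isomorphism in the reverse direction, hence the initial \<open>isomorphic_sym\<close>.\<close>

lemma isomorphic_canonical:
  assumes "infinite A"
    and "\<And>x y. x \<in> A \<Longrightarrow> y \<in> A \<Longrightarrow> (x, y) \<in> \<rho> \<longleftrightarrow> (x, y) \<in> canonical p q r"
  shows "isomorphic (A, \<rho> \<inter> A \<times> A) (UNIV :: nat set, canonical p q r)"
proof (rule isomorphic_sym)
  have bij: "bij_betw (enumerate A) UNIV A"
    using assms(1) by (rule bij_enumerate)
  have sm: "strict_mono (enumerate A)"
    using assms(1) by (simp add: strict_mono_def)
  have "(m, n) \<in> canonical p q r \<longleftrightarrow> (enumerate A m, enumerate A n) \<in> \<rho> \<inter> A \<times> A" for m n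
  proof -
    have "enumerate A m \<in> A" "enumerate A n \<in> A"
      using assms(1) by (simp_all add: enumerate_in_set)
    then show ?thesis
      using assms(2) strict_mono_less[OF sm] strict_mono_eq[OF sm] by (simp add: canonical_def)
  qed
  with bij show "isomorphic (UNIV :: nat set, canonical p q r) (A, \<rho> \<inter> A \<times> A)"
    unfolding isomorphic_def by auto
qed

lemma copies_eq_if_isomorphic_canonical:
  assumes iso: "isomorphic (UNIV :: nat set, \<rho>) (UNIV :: nat set, canonical p q r)"
  shows "copies \<rho> = infinite_sets"
proof
  show "infinite_sets \<subseteq> copies \<rho>"
  proof
    fix A :: "nat set" assume "A \<in> infinite_sets"
    then have A: "infinite A" by (simp add: infinite_sets_def)
    obtain f :: "nat \<Rightarrow> nat" where f: "bij f"
      and r: "\<And>x y. (x, y) \<in> \<rho> \<longleftrightarrow> (f x, f y) \<in> canonical p q r"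
      using iso unfolding isomorphic_def by auto
    have inj: "inj_on f A"
      using bij_is_inj[OF f] by (rule inj_on_subset) simp
    have "isomorphic (A, \<rho> \<inter> A \<times> A) (f ` A, canonical p q r \<inter> f ` A \<times> f ` A)"
      unfolding isomorphic_def using r inj_on_imp_bij_betw[OF inj] by auto
    moreover have "isomorphic (f ` A, canonical p q r \<inter> f ` A \<times> f ` A) (UNIV :: nat set, canonical p q r)"
      using A inj by (intro isomorphic_canonical) (auto dest: finite_imageD)
    ultimately show "A \<in> copies \<rho>"
      unfolding copies_def using isomorphic_trans isomorphic_sym[OF iso] by blast
  qed
qed (rule copies_subset_infinite_sets)

section \<open>Homogeneous sets from Ramsey's theorem\<close>

lemma three_bits_eq_iff:
  "of_bool p + 2 * of_bool q + 4 * of_bool r = (of_bool p' + 2 * of_bool q' + 4 * of_bool r' :: nat)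
    \<longleftrightarrow> (p \<longleftrightarrow> p') \<and> (q \<longleftrightarrow> q') \<and> (r \<longleftrightarrow> r')"
  by (cases p; cases q; cases r; cases p'; cases q'; cases r'; simp)

lemma infinite_homogeneous_subset:
  fixes \<rho> :: "nat rel"
  assumes "infinite Z"
  obtains H p q r where "H \<subseteq> Z" "infinite H"
    "\<And>x y. x \<in> H \<Longrightarrow> y \<in> H \<Longrightarrow> (x, y) \<in> \<rho> \<longleftrightarrow> (x, y) \<in> canonical p q r"
proof -
  \<comment> \<open>\<open>Ramsey2\<close> colours unordered pairs, so a pair is oriented by its
    minimum and maximum. The three bits of a colour record both directions of the relation and the
    loop at the smaller point, which makes eight colours; \<open>three_bits_eq_iff\<close> decodes
    them.\<close>
  define col :: "nat \<Rightarrow> nat \<Rightarrow> nat" where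
    "col x y = of_bool ((x, y) \<in> \<rho>) + 2 * of_bool ((y, x) \<in> \<rho>) + 4 * of_bool ((x, x) \<in> \<rho>)" for x y
  have "\<forall>x\<in>Z. \<forall>y\<in>Z. x \<noteq> y \<longrightarrow> col (Min {x, y}) (Max {x, y}) < 8"
    by (auto simp: col_def)
  with Ramsey2[OF assms, of "\<lambda>X. col (Min X) (Max X)" 8] obtain H t
    where H: "H \<subseteq> Z" "infinite H"
      and t: "\<forall>x\<in>H. \<forall>y\<in>H. x \<noteq> y \<longrightarrow> col (Min {x, y}) (Max {x, y}) = t"
    by blast
  have col: "col x y = t" if "x \<in> H" "y \<in> H" "x < y" for x y
  proof -
    have "Min {x, y} = x" "Max {x, y} = y"
      using that(3) by simp_all
    with t that show ?thesis
      by (metis less_irrefl)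
  qed
  \<comment> \<open>A reference pair \<open>a < b\<close> in \<open>H\<close>: its three truth
    values become the parameters \<open>p\<close>, \<open>q\<close>, \<open>r\<close>.\<close>
  obtain a where a: "a \<in> H"
    using H(2) by (metis finite.emptyI ex_in_conv)
  obtain b where b: "b \<in> H" "a < b"
    using H(2) by (meson infinite_nat_iff_unbounded)
  have "col x y = col a b" if "x \<in> H" "y \<in> H" "x < y" for x y
    using col that a b by simp
  then have same: "((x, y) \<in> \<rho> \<longleftrightarrow> (a, b) \<in> \<rho>) \<and> ((y, x) \<in> \<rho> \<longleftrightarrow> (b, a) \<in> \<rho>) \<and>
      ((x, x) \<in> \<rho> \<longleftrightarrow> (a, a) \<in> \<rho>)" if "x \<in> H" "y \<in> H" "x < y" for x y
    using that unfolding col_def three_bits_eq_iff by blast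
  \<comment> \<open>The colour only sees the loop at the smaller point, but every point of the
    infinite set \<open>H\<close> is the smaller point of some pair in \<open>H\<close>.\<close>
  have loop: "(x, x) \<in> \<rho> \<longleftrightarrow> (a, a) \<in> \<rho>" if "x \<in> H" for x
    using same that H(2) by (meson infinite_nat_iff_unbounded)
  show thesis
  proof (rule that[OF H, of "(a, b) \<in> \<rho>" "(b, a) \<in> \<rho>" "(a, a) \<in> \<rho>"])
    fix x y assume "x \<in> H" "y \<in> H"
    then show "(x, y) \<in> \<rho> \<longleftrightarrow>
        (x, y) \<in> canonical ((a, b) \<in> \<rho>) ((b, a) \<in> \<rho>) ((a, a) \<in> \<rho>)"
      using same[of x y] same[of y x] loop[of x]
      by (cases x y rule: linorder_cases) (auto simp: canonical_def)
  qed
qed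

text \<open>A homogeneous set is chosen below the set where the copies are dense. A copy inside it
  inherits homogeneity, so it is isomorphic both to the whole structure and to a canonical
  relation.\<close>

lemma isomorphic_canonical_if_somewhere_dense:
  assumes "somewhere_dense_in (copies \<rho>) (inclusion_poset infinite_sets)"
  obtains p q r where "isomorphic (UNIV :: nat set, \<rho>) (UNIV :: nat set, canonical p q r)"
proof -
  have "\<exists>Z. infinite Z \<and> (\<forall>H. infinite H \<longrightarrow> H \<subseteq> Z \<longrightarrow> (\<exists>A\<in>copies \<rho>. A \<subseteq> H))"
    using assms by (simp add: somewhere_dense_in_def inclusion_poset_def infinite_sets_def) meson
  then obtain Z where Z: "infinite Z"
    and dense: "\<And>H. infinite H \<Longrightarrow> H \<subseteq> Z \<Longrightarrow> \<exists>A\<in>copies \<rho>. A \<subseteq> H"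
    by blast
  obtain H p q r where H: "H \<subseteq> Z" "infinite H"
    and hom: "\<And>x y. x \<in> H \<Longrightarrow> y \<in> H \<Longrightarrow> (x, y) \<in> \<rho> \<longleftrightarrow> (x, y) \<in> canonical p q r"
    using infinite_homogeneous_subset[OF Z, of \<rho>] by metis
  obtain A where A: "A \<in> copies \<rho>" "A \<subseteq> H"
    using dense H by blast
  have "infinite A"
    using A(1) copies_subset_infinite_sets by (auto simp: infinite_sets_def)
  then have "isomorphic (A, \<rho> \<inter> A \<times> A) (UNIV :: nat set, canonical p q r)"
    using hom A(2) by (intro isomorphic_canonical) blast+
  moreover have "isomorphic (UNIV, \<rho>) (A, \<rho> \<inter> A \<times> A)"
    using A(1) by (auto simp: copies_def intro: isomorphic_sym)
  ultimately show thesis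
    using that isomorphic_trans by blast
qed

text \<open>Copies are infinite, so finite sets always belong to the ideal. The content of the
  equality is that no infinite set does, and this is density.\<close>

lemma copy_ideal_eq_Fin_iff:
  "copy_ideal \<rho> = Fin \<longleftrightarrow> dense_in (copies \<rho>) (inclusion_poset infinite_sets)"
proof -
  have inf: "infinite A" if "A \<in> copies \<rho>" for A
    using that copies_subset_infinite_sets by (auto simp: infinite_sets_def)
  then have "copy_ideal \<rho> = Fin \<longleftrightarrow> (\<forall>I. infinite I \<longrightarrow> (\<exists>A\<in>copies \<rho>. A \<subseteq> I))"
    unfolding set_eq_iff copy_ideal_def Fin_def mem_Collect_eq by (metis finite_subset)
  also have "\<dots> \<longleftrightarrow> dense_in (copies \<rho>) (inclusion_poset infinite_sets)"
    using inf copies_subset_infinite_sets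
    by (simp add: dense_in_def inclusion_poset_def infinite_sets_def)
  finally show ?thesis .
qed

lemma somewhere_dense_if_dense:
  assumes "dense_in S P" "fst P \<noteq> {}"
  shows "somewhere_dense_in S P"
  using assms unfolding dense_in_def somewhere_dense_in_def by blast

section \<open>The separative order of inclusion is almost inclusion\<close>

lemma sep_le_infinite_sets: "sep_le (inclusion_poset infinite_sets) = almost_subset"
proof (rule set_eqI, clarify)
  fix A B :: "nat set"
  have "(A, B) \<in> sep_le (inclusion_poset infinite_sets) \<longleftrightarrow> infinite A \<and> infinite B \<and>
      (\<forall>C. infinite C \<longrightarrow> C \<subseteq> A \<longrightarrow> (\<exists>D. infinite D \<and> D \<subseteq> C \<and> D \<subseteq> B))"
    by (simp add: sep_le_def inclusion_poset_def infinite_sets_def cong: conj_cong)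
  also have "(\<forall>C. infinite C \<longrightarrow> C \<subseteq> A \<longrightarrow> (\<exists>D. infinite D \<and> D \<subseteq> C \<and> D \<subseteq> B)) \<longleftrightarrow>
      finite (A - B)" (is "?L \<longleftrightarrow> _")
  proof
    assume ?L
    show "finite (A - B)"
    proof (rule ccontr)
      \<comment> \<open>The set \<open>A - B\<close> itself refutes \<open>?L\<close>: a subset of
        it that also lies in \<open>B\<close> is empty.\<close>
      assume "infinite (A - B)"
      with \<open>?L\<close> obtain D where "infinite D" "D \<subseteq> A - B" "D \<subseteq> B"
        by (meson Diff_subset)
      then have "D = {}" by blast
      with \<open>infinite D\<close> show False by simp
    qed
  next
    assume fin: "finite (A - B)"
    show ?L
    proof (intro allI impI)
      fix C assume C: "infinite C" "C \<subseteq> A"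
      \<comment> \<open>The points of \<open>C\<close> outside \<open>B\<close> lie in
        \<open>A - B\<close>, so \<open>C \<inter> B\<close> is still infinite and serves as
        \<open>D\<close>.\<close>
      have "finite (C - B)"
        using C(2) by (intro finite_subset[OF _ fin]) blast
      then have "infinite (C \<inter> B)"
        using C(1) by (metis Int_Diff_Un finite_Un)
      then show "\<exists>D. infinite D \<and> D \<subseteq> C \<and> D \<subseteq> B"
        by blast
    qed
  qed
  finally show "(A, B) \<in> sep_le (inclusion_poset infinite_sets) \<longleftrightarrow> (A, B) \<in> almost_subset"
    by (simp add: almost_subset_def)
qed

lemma separative_quotient_infinite_sets:
  "separative_quotient (inclusion_poset infinite_sets) = Pomega_mod_Fin_plus"
  unfolding separative_quotient_def Pomega_mod_Fin_plus_def sep_eq_def sep_le_infinite_sets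
    almost_equal_def
  by (simp add: inclusion_poset_def)

section \<open>Classes modulo finite sets: order, absence of atoms, and lower bounds of
  sequences\<close>

lemma almost_subset_trans:
  assumes "(A, B) \<in> almost_subset" "(B, C) \<in> almost_subset"
  shows "(A, C) \<in> almost_subset"
proof -
  have "A - C \<subseteq> (A - B) \<union> (B - C)" by blast
  then show ?thesis
    using assms finite_subset[of "A - C"] by (auto simp: almost_subset_def)
qed

lemma almost_subsetI:
  assumes "infinite A" "infinite B" "A \<subseteq> B"
  shows "(A, B) \<in> almost_subset"
  using assms by (simp add: almost_subset_def) (metis Diff_eq_empty_iff finite.emptyI)

text \<open>\<open>almost_equal\<close> relates infinite sets only, so the class of a finite set is
  empty. An infinite \<open>B\<close> lies in its own class and therefore in that of
  \<open>A\<close>.\<close>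

lemma almost_equal_classE:
  assumes "almost_equal `` {A} = almost_equal `` {B}" "infinite B"
  shows "(A, B) \<in> almost_equal"
proof -
  have "(B, B) \<in> almost_equal"
    using assms(2) by (simp add: almost_equal_def almost_subsetI)
  with assms(1) show ?thesis by blast
qed

lemma fst_Pomega_mod_Fin_plus:
  "X \<in> fst Pomega_mod_Fin_plus \<longleftrightarrow> (\<exists>A. infinite A \<and> X = almost_equal `` {A})"
  by (auto simp: Pomega_mod_Fin_plus_def quotient_def infinite_sets_def)

text \<open>The order on classes is defined through the existence of suitable representatives;
  transitivity of almost inclusion makes it independent of their choice.\<close>

lemma snd_Pomega_mod_Fin_plus:
  assumes "infinite A" "infinite B"
  shows "(almost_equal `` {A}, almost_equal `` {B}) \<in> snd Pomega_mod_Fin_plus \<longleftrightarrow>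
    (A, B) \<in> almost_subset"
proof
  assume "(almost_equal `` {A}, almost_equal `` {B}) \<in> snd Pomega_mod_Fin_plus"
  then obtain A' B' where eq: "almost_equal `` {A} = almost_equal `` {A'}"
      "almost_equal `` {B} = almost_equal `` {B'}" and le: "(A', B') \<in> almost_subset"
    unfolding Pomega_mod_Fin_plus_def by auto
  have "infinite A'" "infinite B'"
    using le by (simp_all add: almost_subset_def)
  then have "(A, A') \<in> almost_subset" "(B', B) \<in> almost_subset"
    using almost_equal_classE[OF eq(1)] almost_equal_classE[OF eq(2)]
    by (simp_all add: almost_equal_def)
  with le show "(A, B) \<in> almost_subset"
    using almost_subset_trans by blast
qed (auto simp: Pomega_mod_Fin_plus_def)

text \<open>An infinite set splits into two disjoint infinite parts. A set almost contained in both
  parts is finite, so their classes are incompatible.\<close>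

lemma atomless_Pomega_mod_Fin_plus: "atomless Pomega_mod_Fin_plus"
  unfolding atomless_def
proof
  assume "\<exists>X. atom_in Pomega_mod_Fin_plus X"
  then obtain A where A: "infinite A" and atom: "atom_in Pomega_mod_Fin_plus (almost_equal `` {A})"
    by (auto simp: atom_in_def fst_Pomega_mod_Fin_plus)
  obtain B C where BC: "B \<subseteq> A" "C \<subseteq> A" "infinite B" "infinite C" "B \<inter> C = {}"
    using infinite_split[OF A] .
  have below: "almost_equal `` {D} \<in> fst Pomega_mod_Fin_plus"
      "(almost_equal `` {D}, almost_equal `` {A}) \<in> snd Pomega_mod_Fin_plus"
    if "infinite D" "D \<subseteq> A" for D
    using that A fst_Pomega_mod_Fin_plus by (auto simp: snd_Pomega_mod_Fin_plus almost_subsetI)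
  have "compatible_in Pomega_mod_Fin_plus (almost_equal `` {B}) (almost_equal `` {C})"
    using atom below BC(1-4) unfolding atom_in_def by blast
  then obtain D where D: "infinite D" "(D, B) \<in> almost_subset" "(D, C) \<in> almost_subset"
    using BC by (auto simp: compatible_in_def fst_Pomega_mod_Fin_plus snd_Pomega_mod_Fin_plus)
  have "D = (D - B) \<union> (D - C)"
    using BC(5) by blast
  moreover have "finite ((D - B) \<union> (D - C))"
    using D by (simp add: almost_subset_def)
  ultimately show False
    using D(1) by simp
qed

text \<open>A diagonal argument: the sequence decreases only modulo finite sets, but its finite
  intersections are still infinite. Strictly increasing points \<open>x n\<close> are picked from
  them, and their range is \<open>B\<close>.\<close>

lemma pseudo_intersection:
  fixes A :: "nat \<Rightarrow> nat set"
  assumes dec: "\<And>n. (A (Suc n), A n) \<in> almost_subset"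
  obtains B where "\<And>n. (B, A n) \<in> almost_subset"
proof -
  have inf: "infinite (A n)" for n
    using dec[of n] by (simp add: almost_subset_def)
  have fin: "finite (A n - (\<Inter>i\<le>n. A i))" for n
  proof (induction n)
    case (Suc n)
    have "A (Suc n) - (\<Inter>i\<le>Suc n. A i) \<subseteq> (A (Suc n) - A n) \<union> (A n - (\<Inter>i\<le>n. A i))"
      by (auto simp: atMost_Suc)
    moreover have "finite ((A (Suc n) - A n) \<union> (A n - (\<Inter>i\<le>n. A i)))"
      using Suc dec[of n] by (simp add: almost_subset_def)
    ultimately show ?case
      by (rule finite_subset)
  qed simp
  have infI: "infinite (\<Inter>i\<le>n. A i)" for n
    using inf[of n] fin[of n] by (metis Diff_infinite_finite)
  have "\<exists>x. \<forall>n. x n \<in> (\<Inter>i\<le>n. A i) \<and> x n < x (Suc n)"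
  proof (rule dependent_nat_choice)
    show "\<exists>x. x \<in> (\<Inter>i\<le>0. A i)"
      using infI[of 0] by (metis finite.emptyI ex_in_conv)
    show "\<exists>y. y \<in> (\<Inter>i\<le>Suc n. A i) \<and> x < y" for x n
      using infI[of "Suc n"] by (meson infinite_nat_iff_unbounded)
  qed
  then obtain x where x: "\<And>n. x n \<in> (\<Inter>i\<le>n. A i)" and less: "\<And>n. x n < x (Suc n)"
    by blast
  have "inj x"
    using less by (simp add: strict_mono_Suc_iff strict_mono_imp_inj_on)
  then have infx: "infinite (range x)"
    by (rule range_inj_infinite)
  \<comment> \<open>From index \<open>n\<close> on, all chosen points lie in \<open>A n\<close>, so
    only the finitely many earlier ones can fall outside.\<close>
  have "m < n" if "x m \<notin> A n" for m n
    using x[of m] that by (cases "m < n") auto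
  then have "range x - A n \<subseteq> x ` {..<n}" for n
    by auto
  then have "finite (range x - A n)" for n
    by (rule finite_subset) simp
  with infx inf show thesis
    by (intro that[of "range x"]) (simp add: almost_subset_def)
qed

text \<open>Choosing representatives turns a descending sequence of classes into an almost
  decreasing sequence of sets; the class of a pseudo-intersection is a lower bound.\<close>

lemma sigma_closed_Pomega_mod_Fin_plus: "sigma_closed Pomega_mod_Fin_plus"
  unfolding sigma_closed_def
proof (intro allI impI, elim conjE)
  fix X :: "nat \<Rightarrow> nat set set"
  assume "\<forall>n. X n \<in> fst Pomega_mod_Fin_plus"
    and dec: "\<forall>n. (X (Suc n), X n) \<in> snd Pomega_mod_Fin_plus"
  then obtain A where A: "\<And>n. infinite (A n)" and X: "\<And>n. X n = almost_equal `` {A n}"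
    unfolding fst_Pomega_mod_Fin_plus by metis
  have "(A (Suc n), A n) \<in> almost_subset" for n
    using dec A by (simp add: X snd_Pomega_mod_Fin_plus)
  then obtain B where B: "\<And>n. (B, A n) \<in> almost_subset"
    using pseudo_intersection by blast
  then have "infinite B"
    by (simp add: almost_subset_def)
  with A B show "\<exists>Y\<in>fst Pomega_mod_Fin_plus. \<forall>n. (Y, X n) \<in> snd Pomega_mod_Fin_plus"
    by (intro bexI[of _ "almost_equal `` {B}"])
      (auto simp: X snd_Pomega_mod_Fin_plus fst_Pomega_mod_Fin_plus)
qed

theorem theorem6p1:
  fixes \<rho> :: "nat rel"
  defines "a \<equiv> copies \<rho> = infinite_sets"
    and "b \<equiv> dense_in (copies \<rho>) (inclusion_poset infinite_sets)"
    and "c \<equiv> (\<exists>\<sigma> \<in> {{}, UNIV - Id, {(m, n). m < n}, {(m, n). m < n}\<inverse>,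
                    Id, UNIV, {(m, n). m \<le> n}, {(m, n). m \<le> n}\<inverse>}.
                isomorphic (UNIV :: nat set, \<rho>) (UNIV :: nat set, \<sigma>))"
    and "d \<equiv> somewhere_dense_in (copies \<rho>) (inclusion_poset infinite_sets)"
    and "e \<equiv> copy_ideal \<rho> = Fin"
  shows "((a \<longleftrightarrow> b) \<and> (a \<longleftrightarrow> c) \<and> (a \<longleftrightarrow> d) \<and> (a \<longleftrightarrow> e)) \<and>
         (a \<longrightarrow> separative_quotient (inclusion_poset (copies \<rho>)) = Pomega_mod_Fin_plus \<and>
                atomless (separative_quotient (inclusion_poset (copies \<rho>))) \<and>
                sigma_closed (separative_quotient (inclusion_poset (copies \<rho>))))"
proof -
  have c_iff: "c \<longleftrightarrow> (\<exists>p q r. isomorphic (UNIV :: nat set, \<rho>) (UNIV :: nat set, canonical p q r))"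
    unfolding c_def canonical_relations by auto
  have "a \<Longrightarrow> b"
    unfolding a_def b_def dense_in_def inclusion_poset_def by auto
  moreover have "b \<Longrightarrow> d"
    \<comment> \<open>That \<open>UNIV\<close> is a copy shows that the poset of infinite sets is
      nonempty, so there is an element below which the copies are dense.\<close>
    unfolding b_def d_def using UNIV_in_copies copies_subset_infinite_sets
    by (intro somewhere_dense_if_dense) (auto simp: inclusion_poset_def)
  moreover have "d \<Longrightarrow> c"
    unfolding d_def c_iff by (blast elim: isomorphic_canonical_if_somewhere_dense)
  moreover have "c \<Longrightarrow> a"
    unfolding c_iff a_def using copies_eq_if_isomorphic_canonical by blast
  moreover have "e \<longleftrightarrow> b"
    unfolding e_def b_def by (rule copy_ideal_eq_Fin_iff)
  moreover have "a \<Longrightarrow> separative_quotient (inclusion_poset (copies \<rho>)) = Pomega_mod_Fin_plus"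
    unfolding a_def by (simp add: separative_quotient_infinite_sets)
  ultimately show ?thesis
    using atomless_Pomega_mod_Fin_plus sigma_closed_Pomega_mod_Fin_plus by auto
qed

end
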